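(* Let $q\ge 2$, $n\ge 1$ and $0\le r\le n$ be integers, let $\mathbb{E}=[q]^n$, and let $\lambda_0,\ldots,\lambda_n\ge 0$ and $\beta>0$ be real numbers. Suppose that every code $C\subseteq\mathbb{E}$ with covering radius $r$ satisfies the inequalities $(\lambda_0,\ldots,\lambda_n)\beta$. Then $$K_q(n,r)^3\ \ge\ \min_{M,M',M'',N}\ q^n\sum_{\mathbf{u},\mathbf{v}\in\mathbb{E}}M'_{\mathbf{u},\mathbf{v}},$$ where the minimum ranges over all real $\mathbb{E}\times\mathbb{E}$ matrices $M,M',M'',N$ satisfying all of the following conditions. (A) $M$ is $\mathrm{Aut}(q,n)$-invariant, $M'$ and $M''$ are $\mathrm{Aut}_{\mathbf 0}(q,n)$-invariant, and for all $\mathbf{u},\mathbf{v}\in\mathbb{E}$: (i) $M_{\mathbf{u},\mathbf{v}}=M'_{\mathbf 0,\mathbf{v}-\mathbf{u}}$ and $M''_{\mathbf{u},\mathbf{v}}=M'_{\mathbf 0,\mathbf{v}-\mathbf{u}}-M'_{\mathbf{u},\mathbf{v}}$; (ii) $0\le M'_{\mathbf{u},\mathbf{v}}\le M'_{\mathbf 0,\mathbf{u}}$; (iii) $0\le M''_{\mathbf{u},\mathbf{v}}\le M''_{\mathbf{u},\mathbf{u}}$; (iv) $M'_{\mathbf{u},\mathbf{v}}=M'_{\mathbf{u}',\mathbf{v}'}$ whenever $\mathbf{u}',\mathbf{v}'\in\mathbb{E}$ satisfy $\{\mathbf 0,\mathbf{u}',\mathbf{v}'\}=\sigma\{\mathbf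 0,\mathbf{u},\mathbf{v}\}$ for some $\sigma\in\mathrm{Aut}(q,n)$. (B) $M'\succeq 0$, $M''\succeq 0$, and $R(1-M'_{\mathbf 0,\mathbf 0},M'')\succeq 0$. (C) (i) $R(c,N)\succeq 0$, where $c=\sum_{\ell=0}^n\lambda_\ell\,|S_\ell(\mathbf 0)|\,M'_{\mathbf 0,\mathbf 0}-\beta$; (ii) $N$ is $\mathrm{Aut}_{\mathbf 0}(q,n)$-invariant; (iii) for all $\mathbf{u},\mathbf{v}\in\mathbb{E}$: $N_{\mathbf{u},\mathbf{v}}=-\beta M_{\mathbf{u},\mathbf{v}}+\sum_{\ell=0}^n\lambda_\ell\sum_{\mathbf{w}\in S_\ell(\mathbf 0)}M'_{\mathbf{u}-\mathbf{w},\mathbf{v}-\mathbf{w}}$; (iv) for all $\mathbf{u},\mathbf{v}\in\mathbb{E}$: $$\beta M'_{\mathbf 0,\mathbf{u}}\le\sum_{\ell=0}^n\lambda_\ell\sum_{\mathbf{w}\in S_\ell(\mathbf{v})}M'_{\mathbf{u},\mathbf{w}},$$ $$\beta\,(M'_{\mathbf 0,\mathbf 0}-M'_{\mathbf 0,\mathbf{u}})\le\sum_{\ell=0}^n\lambda_\ell\sum_{\mathbf{w}\in S_\ell(\mathbf{v})}(M'_{\mathbf{w},\mathbf{w}}-M'_{\mathbf{u},\mathbf{w}}),$$ $$\beta M''_{\mathbf{u},\mathbf{u}}\le\sum_{\ell=0}^n\lambda_\ell\sum_{\mathbf{w}\in S_\ell(\mathbf{v})}M''_{\mathbf{u},\mathbf{w}},$$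 $$\beta\,\bigl((1-M'_{\mathbf 0,\mathbf 0})-M''_{\mathbf{u},\mathbf{u}}\bigr)\le\sum_{\ell=0}^n\lambda_\ell\sum_{\mathbf{w}\in S_\ell(\mathbf{v})}(M''_{\mathbf{w},\mathbf{w}}-M''_{\mathbf{u},\mathbf{w}}).$$
   Context: $[q]^n=\{0,\ldots,q-1\}^n$, identified with the additive group $(\mathbb{Z}/q\mathbb{Z})^n$; $\mathbf 0$ is the zero word. $d(\mathbf u,\mathbf v)$ is the Hamming distance; $S_\ell(\mathbf u)=\{\mathbf v\in[q]^n: d(\mathbf u,\mathbf v)=\ell\}$ and $B_r(\mathbf u)=\{\mathbf v\in[q]^n: d(\mathbf u,\mathbf v)\le r\}$. $\mathrm{Aut}(q,n)$ is the isometry group of $[q]^n$: all permutations of $[q]^n$ obtained by permuting the $n$ positions and independently permuting the $q$ symbols in each position; $\mathrm{Aut}_{\mathbf 0}(q,n)$ is the stabilizer of $\mathbf 0$. A permutation $\sigma$ acts on matrices by $(\sigma A)_{\mathbf u,\mathbf v}=A_{\sigma^{-1}(\mathbf u),\sigma^{-1}(\mathbf v)}$, and a matrix is invariant under a group if it is fixed by all its elements. The covering radius of a code $C\subseteq[q]^n$ is the smallest integer $r$ with $\bigcup_{\mathbf u\in C}B_r(\mathbf u)=[q]^n$, and $K_q(n,r)=\min\{|C| : C\subseteq[q]^n \text{ has covering radius } r\}$. A code $C$ satisfies $(\lambda_0,\ldots,\lambda_n)\beta$ if $\sum_{i=0}^n\lambda_i\,|C\cap S_i(\mathbf u)|\ge\beta$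 for all $\mathbf u\in[q]^n$. For a square matrix $A$ with diagonal vector $\operatorname{diag}A$ and a scalar $c$, $R(c,A)=\begin{pmatrix}c&(\operatorname{diag}A)^{\mathsf T}\\ \operatorname{diag}A&A\end{pmatrix}$ (for real $A$). $A\succeq 0$ means $A$ is (symmetric) positive semidefinite. *)

theory Defs
  imports Complex_Main "HOL-Library.FuncSet" "HOL-Combinatorics.Permutations"
begin

text \<open>
  A word of length \<open>n\<close> over \<open>{0, ..., q-1}\<close> is an extensional function on \<open>{..<n}\<close>.
  Matrices indexed by a finite set \<open>E\<close> are two-argument functions of which only the values on
  \<open>E \<times> E\<close> matter.
\<close>

type_synonym qword = "nat \<Rightarrow> int"

definition words :: "nat \<Rightarrow> nat \<Rightarrow> qword set" where
  "words q n = {..<n} \<rightarrow>\<^sub>E {0..<int q}"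

definition zero_word :: "nat \<Rightarrow> qword" where
  "zero_word n = (\<lambda>i\<in>{..<n}. 0)"

definition word_diff :: "nat \<Rightarrow> nat \<Rightarrow> qword \<Rightarrow> qword \<Rightarrow> qword" where
  "word_diff q n u v = (\<lambda>i\<in>{..<n}. (u i - v i) mod int q)"

definition hdist :: "nat \<Rightarrow> qword \<Rightarrow> qword \<Rightarrow> nat" where
  "hdist n u v = card {i. i < n \<and> u i \<noteq> v i}"

definition hsphere :: "nat \<Rightarrow> nat \<Rightarrow> nat \<Rightarrow> qword \<Rightarrow> qword set" where
  "hsphere q n l u = {v \<in> words q n. hdist n u v = l}"

definition hball :: "nat \<Rightarrow> nat \<Rightarrow> nat \<Rightarrow> qword \<Rightarrow> qword set" where
  "hball q n r u = {v \<in> words q n. hdist n u v \<le> r}"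

text \<open>
  Elements of the isometry group are total functions that are the identity off the set of words
  (as for the library's \<open>permutes\<close>), so that \<open>inv\<close> is the group inverse.
\<close>

definition Aut :: "nat \<Rightarrow> nat \<Rightarrow> (qword \<Rightarrow> qword) set" where
  "Aut q n = {\<sigma>. \<sigma> permutes words q n \<and>
     (\<exists>\<pi> \<rho>. \<pi> permutes {..<n} \<and> (\<forall>i<n. \<rho> i permutes {0..<int q}) \<and>
        (\<forall>u\<in>words q n. \<forall>i<n. \<sigma> u i = \<rho> i (u (\<pi> i))))}"

definition Aut0 :: "nat \<Rightarrow> nat \<Rightarrow> (qword \<Rightarrow> qword) set" where
  "Aut0 q n = {\<sigma> \<in> Aut q n. \<sigma> (zero_word n) = zero_word n}"

definition mat_act :: "('a \<Rightarrow> 'a) \<Rightarrow> ('a \<Rightarrow> 'a \<Rightarrow> real) \<Rightarrow> 'a \<Rightarrow> 'a \<Rightarrow> real" where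
  "mat_act \<sigma> A u v = A (inv \<sigma> u) (inv \<sigma> v)"

definition mat_invariant ::
  "'a set \<Rightarrow> ('a \<Rightarrow> 'a) set \<Rightarrow> ('a \<Rightarrow> 'a \<Rightarrow> real) \<Rightarrow> bool" where
  "mat_invariant E G A \<longleftrightarrow> (\<forall>\<sigma>\<in>G. \<forall>u\<in>E. \<forall>v\<in>E. mat_act \<sigma> A u v = A u v)"

text \<open>
  Stated as a relation because the empty code has no covering radius.
\<close>

definition has_covering_radius :: "nat \<Rightarrow> nat \<Rightarrow> qword set \<Rightarrow> nat \<Rightarrow> bool" where
  "has_covering_radius q n C r \<longleftrightarrow>
     (\<Union>u\<in>C. hball q n r u) = words q n \<and>
     (\<forall>s. (\<Union>u\<in>C. hball q n s u) = words q n \<longrightarrow> r \<le> s)"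

definition covering_number :: "nat \<Rightarrow> nat \<Rightarrow> nat \<Rightarrow> nat" where
  "covering_number q n r = Min {card C | C. C \<subseteq> words q n \<and> has_covering_radius q n C r}"

definition satisfies_ineqs ::
  "nat \<Rightarrow> nat \<Rightarrow> (nat \<Rightarrow> real) \<Rightarrow> real \<Rightarrow> qword set \<Rightarrow> bool" where
  "satisfies_ineqs q n lam \<beta> C \<longleftrightarrow>
     (\<forall>u\<in>words q n. (\<Sum>i\<le>n. lam i * real (card (C \<inter> hsphere q n i u))) \<ge> \<beta>)"

definition psd_on :: "'a set \<Rightarrow> ('a \<Rightarrow> 'a \<Rightarrow> real) \<Rightarrow> bool" where
  "psd_on I A \<longleftrightarrow>
     (\<forall>i\<in>I. \<forall>j\<in>I. A i j = A j i) \<and>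
     (\<forall>x :: 'a \<Rightarrow> real. 0 \<le> (\<Sum>i\<in>I. \<Sum>j\<in>I. x i * A i j * x j))"

text \<open>
  The bordered matrix \<open>R(c, A)\<close>; \<open>None\<close> is the index of the additional row and column.
\<close>

fun bordered :: "real \<Rightarrow> ('a \<Rightarrow> 'a \<Rightarrow> real) \<Rightarrow> 'a option \<Rightarrow> 'a option \<Rightarrow> real" where
  "bordered c A None None = c"
| "bordered c A None (Some v) = A v v"
| "bordered c A (Some u) None = A u u"
| "bordered c A (Some u) (Some v) = A u v"

definition bordered_psd_on :: "'a set \<Rightarrow> real \<Rightarrow> ('a \<Rightarrow> 'a \<Rightarrow> real) \<Rightarrow> bool" where
  "bordered_psd_on E c A \<longleftrightarrow> psd_on (insert None (Some ` E)) (bordered c A)"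

type_synonym qmat = "qword \<Rightarrow> qword \<Rightarrow> real"

definition cond_A :: "nat \<Rightarrow> nat \<Rightarrow> qmat \<Rightarrow> qmat \<Rightarrow> qmat \<Rightarrow> bool" where
  "cond_A q n M M' M'' \<longleftrightarrow>
     (let E = words q n; z = zero_word n in
       mat_invariant E (Aut q n) M \<and>
       mat_invariant E (Aut0 q n) M' \<and>
       mat_invariant E (Aut0 q n) M'' \<and>
       (\<forall>u\<in>E. \<forall>v\<in>E.
          M u v = M' z (word_diff q n v u) \<and>
          M'' u v = M' z (word_diff q n v u) - M' u v) \<and>
       (\<forall>u\<in>E. \<forall>v\<in>E. 0 \<le> M' u v \<and> M' u v \<le> M' z u) \<and>
       (\<forall>u\<in>E. \<forall>v\<in>E. 0 \<le> M'' u v \<and> M'' u v \<le> M'' u u) \<and>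
       (\<forall>u\<in>E. \<forall>v\<in>E. \<forall>u'\<in>E. \<forall>v'\<in>E.
          (\<exists>\<sigma>\<in>Aut q n. {z, u', v'} = \<sigma> ` {z, u, v}) \<longrightarrow> M' u v = M' u' v'))"

definition cond_B :: "nat \<Rightarrow> nat \<Rightarrow> qmat \<Rightarrow> qmat \<Rightarrow> bool" where
  "cond_B q n M' M'' \<longleftrightarrow>
     (let E = words q n; z = zero_word n in
       psd_on E M' \<and> psd_on E M'' \<and> bordered_psd_on E (1 - M' z z) M'')"

definition cond_C ::
  "nat \<Rightarrow> nat \<Rightarrow> (nat \<Rightarrow> real) \<Rightarrow> real \<Rightarrow> qmat \<Rightarrow> qmat \<Rightarrow> qmat \<Rightarrow> qmat \<Rightarrow> bool" where
  "cond_C q n lam \<beta> M M' M'' N \<longleftrightarrow>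
     (let E = words q n; z = zero_word n in
       bordered_psd_on E ((\<Sum>l\<le>n. lam l * real (card (hsphere q n l z)) * M' z z) - \<beta>) N \<and>
       mat_invariant E (Aut0 q n) N \<and>
       (\<forall>u\<in>E. \<forall>v\<in>E. N u v = - \<beta> * M u v +
          (\<Sum>l\<le>n. lam l * (\<Sum>w\<in>hsphere q n l z. M' (word_diff q n u w) (word_diff q n v w)))) \<and>
       (\<forall>u\<in>E. \<forall>v\<in>E.
          \<beta> * M' z u \<le> (\<Sum>l\<le>n. lam l * (\<Sum>w\<in>hsphere q n l v. M' u w)) \<and>
          \<beta> * (M' z z - M' z u) \<le> (\<Sum>l\<le>n. lam l * (\<Sum>w\<in>hsphere q n l v. M' w w - M' u w)) \<and>
          \<beta> * M'' u u \<le> (\<Sum>l\<le>n. lam l * (\<Sum>w\<in>hsphere q n l v. M'' u w)) \<and>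
          \<beta> * ((1 - M' z z) - M'' u u) \<le>
            (\<Sum>l\<le>n. lam l * (\<Sum>w\<in>hsphere q n l v. M'' w w - M'' u w))))"

definition sdp_values :: "nat \<Rightarrow> nat \<Rightarrow> (nat \<Rightarrow> real) \<Rightarrow> real \<Rightarrow> real set" where
  "sdp_values q n lam \<beta> =
     {real q ^ n * (\<Sum>u\<in>words q n. \<Sum>v\<in>words q n. M' u v) | M M' M'' N.
        cond_A q n M M' M'' \<and> cond_B q n M' M'' \<and> cond_C q n lam \<beta> M M' M'' N}"

end

theory Submission
  imports Defs
begin

text \<open>
  Averaging over all images \<open>D = \<sigma> C\<close> of a code \<open>C\<close> of covering radius \<open>r\<close> and minimum size, let
  \<open>M\<close> be the mean of \<open>\<chi>\<^sub>D \<chi>\<^sub>D\<^sup>T\<close>, let \<open>M'\<close> and \<open>M''\<close> be the means of the same matrices restricted to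
  those \<open>D\<close> that contain, respectively avoid, the zero word, and let \<open>N\<close> be the mean weighted by the
  nonnegative excess \<open>\<Sum>\<^sub>l \<lambda>\<^sub>l |D \<inter> S\<^sub>l(0)| - \<beta>\<close>. Bordering a rank one matrix \<open>\<chi> \<chi>\<^sup>T\<close> by its diagonal gives
  \<open>(1, \<chi>) (1, \<chi>)\<^sup>T\<close>, so all semidefinite constraints hold, and the linear ones are translation
  invariance of the mean or averages of the covering inequalities. The objective value is \<open>|C|\<^sup>3\<close>.
  The minimum is attained because the feasible \<open>M'\<close> have entries in \<open>[0, 1]\<close>, form a closed set and
  determine \<open>M\<close>, \<open>M''\<close> and \<open>N\<close>.
\<close>

section \<open>The isometry group\<close>

lemma finite_words [simp]: "finite (words q n)"
  unfolding words_def by (intro finite_PiE) auto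

lemma card_words: "card (words q n) = q ^ n"
  unfolding words_def by (simp add: card_PiE)

lemma words_nth: "u \<in> words q n \<Longrightarrow> i < n \<Longrightarrow> u i \<in> {0..<int q}"
  unfolding words_def by (simp add: PiE_iff)

lemma words_eqI: "u \<in> words q n \<Longrightarrow> v \<in> words q n \<Longrightarrow> (\<And>i. i < n \<Longrightarrow> u i = v i) \<Longrightarrow> u = v"
  unfolding words_def by (rule PiE_ext) auto

lemma zero_word_in_words: "q > 0 \<Longrightarrow> zero_word n \<in> words q n"
  unfolding words_def zero_word_def by auto

lemma word_diff_in_words: "q > 0 \<Longrightarrow> word_diff q n u v \<in> words q n"
  unfolding words_def word_diff_def by auto

lemma hsphere_subset: "hsphere q n l u \<subseteq> words q n"
  unfolding hsphere_def by auto

lemma finite_hsphere [simp]: "finite (hsphere q n l u)"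
  using finite_subset[OF hsphere_subset finite_words] .

lemma Aut_permutes: "\<sigma> \<in> Aut q n \<Longrightarrow> \<sigma> permutes words q n"
  unfolding Aut_def by auto

lemma AutE:
  assumes "\<sigma> \<in> Aut q n"
  obtains \<pi> \<rho> where "\<pi> permutes {..<n}" "\<And>i. i < n \<Longrightarrow> \<rho> i permutes {0..<int q}"
    "\<And>u i. u \<in> words q n \<Longrightarrow> i < n \<Longrightarrow> \<sigma> u i = \<rho> i (u (\<pi> i))"
  using assms unfolding Aut_def by blast

lemma finite_Aut [simp]: "finite (Aut q n)"
  by (rule finite_subset[OF _ finite_permutations[OF finite_words[of q n]]]) (auto simp: Aut_permutes)

lemma id_in_Aut: "id \<in> Aut q n"
proof -
  have "\<exists>\<pi> \<rho>. \<pi> permutes {..<n} \<and> (\<forall>i<n. \<rho> i permutes {0..<int q}) \<and>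
      (\<forall>u\<in>words q n. \<forall>i<n. id u i = \<rho> i (u (\<pi> i)))"
    by (rule exI[of _ id], rule exI[of _ "\<lambda>_. id"]) auto
  then show ?thesis
    unfolding Aut_def by simp
qed

text \<open>Chaining the two coordinate formulas gives
  \<open>\<rho> i (\<rho>' (\<pi> i) (u (\<pi>' (\<pi> i))))\<close>: the position permutations
  compose in reversed order, and the inner symbol permutation is the one attached to position
  \<open>\<pi> i\<close>.\<close>

lemma Aut_comp:
  assumes "\<sigma> \<in> Aut q n" "\<tau> \<in> Aut q n"
  shows "\<sigma> \<circ> \<tau> \<in> Aut q n"
proof -
  obtain \<pi> \<rho> where \<sigma>: "\<pi> permutes {..<n}" "\<And>i. i < n \<Longrightarrow> \<rho> i permutes {0..<int q}"
      "\<And>u i. u \<in> words q n \<Longrightarrow> i < n \<Longrightarrow> \<sigma> u i = \<rho> i (u (\<pi> i))"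
    using AutE[OF assms(1)] by blast
  obtain \<pi>' \<rho>' where \<tau>: "\<pi>' permutes {..<n}" "\<And>i. i < n \<Longrightarrow> \<rho>' i permutes {0..<int q}"
      "\<And>u i. u \<in> words q n \<Longrightarrow> i < n \<Longrightarrow> \<tau> u i = \<rho>' i (u (\<pi>' i))"
    using AutE[OF assms(2)] by blast
  have \<pi>: "\<pi> i < n" if "i < n" for i
    using permutes_in_image[OF \<sigma>(1), of i] that by simp
  have \<tau>_words: "\<tau> u \<in> words q n" if "u \<in> words q n" for u
    using permutes_in_image[OF Aut_permutes[OF assms(2)]] that by simp
  have "\<pi>' \<circ> \<pi> permutes {..<n}"
    using \<sigma>(1) \<tau>(1) by (rule permutes_compose)
  moreover have "\<forall>i<n. \<rho> i \<circ> \<rho>' (\<pi> i) permutes {0..<int q}"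
    using \<sigma>(2) \<tau>(2) \<pi> by (auto intro: permutes_compose)
  moreover have "\<forall>u\<in>words q n. \<forall>i<n. (\<sigma> \<circ> \<tau>) u i = (\<rho> i \<circ> \<rho>' (\<pi> i)) (u ((\<pi>' \<circ> \<pi>) i))"
    using \<sigma>(3) \<tau>(3) \<pi> \<tau>_words by simp
  moreover have "\<sigma> \<circ> \<tau> permutes words q n"
    using permutes_compose[OF Aut_permutes[OF assms(2)] Aut_permutes[OF assms(1)]] .
  ultimately show ?thesis
    unfolding Aut_def by (intro CollectI conjI exI[of _ "\<pi>' \<circ> \<pi>"] exI[of _ "\<lambda>i. \<rho> i \<circ> \<rho>' (\<pi> i)"]) auto
qed

text \<open>Symbol permutations are injective, so they neither create nor remove disagreements; the
  positions of disagreement are merely pulled back along the bijection \<open>\<pi>\<close>.\<close>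

lemma Aut_hdist:
  assumes "\<sigma> \<in> Aut q n" "u \<in> words q n" "v \<in> words q n"
  shows "hdist n (\<sigma> u) (\<sigma> v) = hdist n u v"
proof -
  obtain \<pi> \<rho> where \<sigma>: "\<pi> permutes {..<n}" "\<And>i. i < n \<Longrightarrow> \<rho> i permutes {0..<int q}"
      "\<And>u i. u \<in> words q n \<Longrightarrow> i < n \<Longrightarrow> \<sigma> u i = \<rho> i (u (\<pi> i))"
    using AutE[OF assms(1)] by blast
  have "{i. i < n \<and> \<sigma> u i \<noteq> \<sigma> v i} = {i. i < n \<and> u (\<pi> i) \<noteq> v (\<pi> i)}"
    using \<sigma>(3)[OF assms(2)] \<sigma>(3)[OF assms(3)] permutes_inj[OF \<sigma>(2)] by (auto simp: inj_eq)
  also have "\<dots> = \<pi> -` {i. i < n \<and> u i \<noteq> v i}"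
    using permutes_in_image[OF \<sigma>(1)] by auto
  also have "card \<dots> = card {i. i < n \<and> u i \<noteq> v i}"
    using permutes_inj[OF \<sigma>(1)] permutes_surj[OF \<sigma>(1)] by (intro card_vimage_inj) auto
  finally show ?thesis
    unfolding hdist_def .
qed

section \<open>Translations of words modulo \<open>q\<close>\<close>

definition translation :: "nat \<Rightarrow> nat \<Rightarrow> qword \<Rightarrow> qword \<Rightarrow> qword" where
  "translation q n w u = (if u \<in> words q n then \<lambda>i\<in>{..<n}. (u i + w i) mod int q else u)"

lemma permutes_add_mod:
  assumes "(q::nat) > 0"
  shows "(\<lambda>x. if x \<in> {0..<int q} then (x + a) mod int q else x) permutes {0..<int q}"
proof (rule bij_imp_permutes)
  have "inj_on (\<lambda>x. (x + a) mod int q) {0..<int q}"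
  proof (rule inj_onI)
    fix x y assume "x \<in> {0..<int q}" "y \<in> {0..<int q}" "(x + a) mod int q = (y + a) mod int q"
    then show "x = y"
      \<comment> \<open>Subtracting \<open>a\<close> modulo \<open>q\<close> recovers a residue that
        already lies in the range from 0 to q - 1.\<close>
      by (metis add_diff_cancel_right' atLeastLessThan_iff mod_diff_left_eq mod_pos_pos_trivial)
  qed
  then have "bij_betw (\<lambda>x. (x + a) mod int q) {0..<int q} {0..<int q}"
    using assms by (intro bij_betw_imageI endo_inj_surj) auto
  then show "bij_betw (\<lambda>x. if x \<in> {0..<int q} then (x + a) mod int q else x) {0..<int q} {0..<int q}"
    by (rule bij_betw_cong[THEN iffD1, rotated]) auto
qed auto

text \<open>Positions stay fixed, and position \<open>i\<close> gets the cyclic shift of the symbols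
  by \<open>w i\<close>. Elements of \<open>Aut\<close> are the identity off the words, which the
  second branch of \<open>translation\<close> provides.\<close>

lemma translation_in_Aut:
  assumes "q > 0"
  shows "translation q n w \<in> Aut q n"
proof -
  define \<rho> where "\<rho> i = (\<lambda>x. if x \<in> {0..<int q} then (x + w i) mod int q else x)" for i
  have \<rho>: "\<rho> i permutes {0..<int q}" for i
    unfolding \<rho>_def using permutes_add_mod[OF assms] .
  have eq: "translation q n w u i = \<rho> i (u i)" if "u \<in> words q n" "i < n" for u i
    using words_nth[OF that] that unfolding translation_def \<rho>_def by simp
  have mem: "translation q n w u \<in> words q n" if "u \<in> words q n" for u
    using assms that unfolding translation_def words_def by auto
  have "inj_on (translation q n w) (words q n)"
  proof (rule inj_onI)
    fix u v assume uv: "u \<in> words q n" "v \<in> words q n" "translation q n w u = translation q n w v"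
    show "u = v"
      using uv(1,2)
    proof (rule words_eqI)
      fix i assume "i < n"
      then have "\<rho> i (u i) = \<rho> i (v i)"
        using uv eq by metis
      then show "u i = v i"
        using permutes_inj[OF \<rho>] by (auto dest: injD)
    qed
  qed
  then have "bij_betw (translation q n w) (words q n) (words q n)"
    using mem by (intro bij_betw_imageI endo_inj_surj) auto
  then have "translation q n w permutes words q n"
    by (rule bij_imp_permutes) (simp add: translation_def)
  moreover have "\<exists>\<pi> \<rho>. \<pi> permutes {..<n} \<and> (\<forall>i<n. \<rho> i permutes {0..<int q}) \<and>
      (\<forall>u\<in>words q n. \<forall>i<n. translation q n w u i = \<rho> i (u (\<pi> i)))"
    by (rule exI[of _ id], rule exI[of _ \<rho>]) (auto simp: \<rho> eq)
  ultimately show ?thesis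
    unfolding Aut_def by simp
qed

text \<open>Together with the image of the zero word, this makes translation by \<open>w\<close>
  carry the triple of zero, \<open>u - w\<close>, \<open>v - w\<close> to \<open>w\<close>,
  \<open>u\<close>, \<open>v\<close>. That is how differences of words in the constraints are
  removed.\<close>

lemma translation_word_diff:
  assumes "u \<in> words q n" "q > 0"
  shows "translation q n w (word_diff q n u w) = u"
proof (rule words_eqI)
  show "translation q n w (word_diff q n u w) \<in> words q n"
    using translation_in_Aut[OF assms(2)] word_diff_in_words[OF assms(2)]
    by (meson Aut_permutes permutes_in_image)
  fix i assume "i < n"
  then show "translation q n w (word_diff q n u w) i = u i"
    using words_nth[OF assms(1)] word_diff_in_words[OF assms(2)]
    by (simp add: translation_def word_diff_def mod_add_left_eq)
qed (use assms in auto)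

lemma translation_zero:
  assumes "w \<in> words q n" "q > 0"
  shows "translation q n w (zero_word n) = w"
proof -
  have "word_diff q n w w = zero_word n"
    unfolding word_diff_def zero_word_def by simp
  then show ?thesis
    using translation_word_diff[OF assms, of w] by simp
qed

text \<open>An isometry maps the sphere around \<open>v\<close> onto the sphere around
  \<open>\<sigma> v\<close>, so the image code has at \<open>\<sigma> v\<close> the same sphere
  counts as \<open>C\<close> at \<open>v\<close>.\<close>

lemma satisfies_ineqs_Aut_image:
  assumes "\<sigma> \<in> Aut q n" "C \<subseteq> words q n" "satisfies_ineqs q n lam \<beta> C"
  shows "satisfies_ineqs q n lam \<beta> (\<sigma> ` C)"
  unfolding satisfies_ineqs_def
proof
  fix u assume "u \<in> words q n"
  then obtain v where v: "v \<in> words q n" "u = \<sigma> v"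
    using permutes_image[OF Aut_permutes[OF assms(1)]] by blast
  have "\<sigma> ` C \<inter> hsphere q n i u = \<sigma> ` (C \<inter> hsphere q n i v)" for i
    using assms(2) v Aut_hdist[OF assms(1)] permutes_in_image[OF Aut_permutes[OF assms(1)]]
    unfolding hsphere_def by (auto simp: subset_iff)
  moreover have "card (\<sigma> ` A) = card A" for A
    using permutes_inj[OF Aut_permutes[OF assms(1)]] by (metis card_image inj_on_subset subset_UNIV)
  ultimately show "\<beta> \<le> (\<Sum>i\<le>n. lam i * real (card (\<sigma> ` C \<inter> hsphere q n i u)))"
    using assms(3) v unfolding satisfies_ineqs_def by simp
qed

section \<open>Codes with a given covering radius\<close>

text \<open>Ensures that the \<open>Min\<close> in \<open>covering_number\<close> is taken over a
  nonempty set.\<close>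

lemma exists_code_with_covering_radius:
  assumes "q \<ge> 2" "r \<le> n"
  shows "\<exists>C\<subseteq>words q n. has_covering_radius q n C r"
proof -
  \<comment> \<open>Clearing the first \<open>r\<close> positions of any word reaches this code in
    at most \<open>r\<close> changes.\<close>
  define C where "C = {u \<in> words q n. \<forall>i<r. u i = 0}"
  have "\<exists>c\<in>C. v \<in> hball q n r c" if v: "v \<in> words q n" for v
  proof
    define c where "c = (\<lambda>i. if i < r then 0 else v i)"
    show "c \<in> C"
      using v assms unfolding C_def c_def words_def by (auto simp: PiE_iff extensional_def)
    have "{i. i < n \<and> c i \<noteq> v i} \<subseteq> {..<r}"
      unfolding c_def by auto
    then have "hdist n c v \<le> r"
      unfolding hdist_def using card_mono[OF finite_lessThan] by fastforce
    then show "v \<in> hball q n r c"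
      using v unfolding hball_def by simp
  qed
  then have cover: "(\<Union>u\<in>C. hball q n r u) = words q n"
    unfolding hball_def by fast
  have "r \<le> s" if s: "(\<Union>u\<in>C. hball q n s u) = words q n" for s
  proof -
    \<comment> \<open>The all-ones word disagrees with every codeword in the first \<open>r\<close>
      positions; \<open>q \<ge> 2\<close> makes 1 a symbol.\<close>
    define v where "v = (\<lambda>i\<in>{..<n}. 1 :: int)"
    have "v \<in> words q n"
      using assms unfolding v_def words_def by auto
    then obtain c where c: "c \<in> C" "hdist n c v \<le> s"
      using s unfolding hball_def by blast
    have "{..<r} \<subseteq> {i. i < n \<and> c i \<noteq> v i}"
      using c(1) assms(2) unfolding C_def v_def by auto
    then have "card {..<r} \<le> hdist n c v"
      unfolding hdist_def by (rule card_mono[rotated]) auto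
    then show ?thesis
      using c(2) by simp
  qed
  then have "has_covering_radius q n C r"
    unfolding has_covering_radius_def using cover by simp
  moreover have "C \<subseteq> words q n"
    unfolding C_def by simp
  ultimately show ?thesis
    by (intro exI[of _ C] conjI)
qed

lemma covering_number_attained:
  assumes "q \<ge> 2" "r \<le> n"
  obtains C where "C \<subseteq> words q n" "has_covering_radius q n C r" "card C = covering_number q n r"
proof -
  let ?S = "{card C | C. C \<subseteq> words q n \<and> has_covering_radius q n C r}"
  have "?S \<subseteq> card ` Pow (words q n)"
    by blast
  then have "finite ?S"
    by (rule finite_subset) simp
  moreover have "?S \<noteq> {}"
    using exists_code_with_covering_radius[OF assms] by blast
  ultimately have "Min ?S \<in> ?S"
    by (rule Min_in)
  then show thesis
    using that unfolding covering_number_def by auto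
qed

section \<open>Semidefinite matrices and pointwise limits\<close>

text \<open>A nonnegative combination of rank one matrices: its quadratic form at \<open>x\<close>
  is a weighted sum of the squares of the inner products of \<open>x\<close> with the vectors
  \<open>f s\<close>.\<close>

lemma psd_onI_mean:
  assumes "\<And>i j. i \<in> I \<Longrightarrow> j \<in> I \<Longrightarrow> A i j = (\<Sum>s\<in>S. wt s * f s i * f s j) / d"
    and "\<And>s. s \<in> S \<Longrightarrow> 0 \<le> wt s" "0 \<le> d"
  shows "psd_on I A"
  unfolding psd_on_def
proof (intro conjI allI ballI)
  fix i j assume "i \<in> I" "j \<in> I"
  then show "A i j = A j i"
    by (simp add: assms(1) mult_ac)
next
  fix x :: "'a \<Rightarrow> real"
  have "(\<Sum>i\<in>I. \<Sum>j\<in>I. x i * A i j * x j) =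
      (\<Sum>i\<in>I. \<Sum>j\<in>I. \<Sum>s\<in>S. wt s * (x i * f s i) * (x j * f s j)) / d"
    by (simp add: assms(1) sum_divide_distrib sum_distrib_left sum_distrib_right mult_ac)
  \<comment> \<open>Two exchanges bring \<open>s\<close> outermost, so that the inner double sum
    factors into a square.\<close>
  also have "(\<Sum>i\<in>I. \<Sum>j\<in>I. \<Sum>s\<in>S. wt s * (x i * f s i) * (x j * f s j)) =
      (\<Sum>i\<in>I. \<Sum>s\<in>S. \<Sum>j\<in>I. wt s * (x i * f s i) * (x j * f s j))"
    by (intro sum.cong refl sum.swap)
  also have "\<dots> = (\<Sum>s\<in>S. \<Sum>i\<in>I. \<Sum>j\<in>I. wt s * (x i * f s i) * (x j * f s j))"
    by (rule sum.swap)
  also have "\<dots> = (\<Sum>s\<in>S. wt s * (\<Sum>i\<in>I. x i * f s i)\<^sup>2)"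
    unfolding power2_eq_square sum_product by (simp add: sum_distrib_left mult.assoc)
  finally show "0 \<le> (\<Sum>i\<in>I. \<Sum>j\<in>I. x i * A i j * x j)"
    using assms(2,3) by (simp add: sum_nonneg)
qed

lemma psd_on_diag_nonneg:
  assumes "psd_on I A" "finite I" "i \<in> I"
  shows "0 \<le> A i i"
proof -
  \<comment> \<open>The form is tested on the unit vector at \<open>i\<close>.\<close>
  have "0 \<le> (\<Sum>j\<in>I. \<Sum>k\<in>I. of_bool (j = i) * A j k * of_bool (k = i))"
    using assms(1) unfolding psd_on_def by (auto dest: spec[of _ "\<lambda>j. of_bool (j = i)"])
  also have "\<dots> = (\<Sum>j\<in>I. if j = i then \<Sum>k\<in>I. if k = i then A j k else 0 else 0)"
    by (intro sum.cong refl) (auto intro!: sum.cong)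
  also have "\<dots> = A i i"
    using assms(2,3) by simp
  finally show ?thesis .
qed

text \<open>For each fixed \<open>x\<close> the quadratic form is linear in the entries, so its sign
  survives entrywise limits.\<close>

lemma psd_on_limit:
  assumes "\<And>k. psd_on I (A k)"
    and lim: "\<And>i j. i \<in> I \<Longrightarrow> j \<in> I \<Longrightarrow> (\<lambda>k::nat. A k i j) \<longlonglongrightarrow> B i j"
  shows "psd_on I B"
  unfolding psd_on_def
proof (intro conjI allI ballI)
  fix i j assume ij: "i \<in> I" "j \<in> I"
  have "A k i j = A k j i" for k
    using assms(1) ij unfolding psd_on_def by blast
  then show "B i j = B j i"
    using lim[OF ij] lim[OF ij(2,1)] LIMSEQ_unique by simp
next
  fix x :: "'a \<Rightarrow> real"
  have "(\<lambda>k. \<Sum>i\<in>I. \<Sum>j\<in>I. x i * A k i j * x j) \<longlonglongrightarrow> (\<Sum>i\<in>I. \<Sum>j\<in>I. x i * B i j * x j)"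
    by (intro tendsto_intros lim)
  then show "0 \<le> (\<Sum>i\<in>I. \<Sum>j\<in>I. x i * B i j * x j)"
    by (rule LIMSEQ_le_const) (use assms(1) in \<open>auto simp: psd_on_def\<close>)
qed

lemma bordered_psd_on_limit:
  assumes "\<And>k. bordered_psd_on E (c k) (A k)" "c \<longlonglongrightarrow> d"
    and "\<And>i j. i \<in> E \<Longrightarrow> j \<in> E \<Longrightarrow> (\<lambda>k::nat. A k i j) \<longlonglongrightarrow> B i j"
  shows "bordered_psd_on E d B"
  unfolding bordered_psd_on_def
proof (rule psd_on_limit)
  show "psd_on (insert None (Some ` E)) (bordered (c k) (A k))" for k
    using assms(1) unfolding bordered_psd_on_def .
qed (use assms(2,3) in auto)

lemma mat_invariant_limit:
  assumes "\<And>k. mat_invariant E G (A k)" "\<And>\<sigma>. \<sigma> \<in> G \<Longrightarrow> \<sigma> permutes E"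
    and lim: "\<And>i j. i \<in> E \<Longrightarrow> j \<in> E \<Longrightarrow> (\<lambda>k::nat. A k i j) \<longlonglongrightarrow> B i j"
  shows "mat_invariant E G B"
  unfolding mat_invariant_def mat_act_def
proof (intro ballI)
  fix \<sigma> u v assume \<sigma>: "\<sigma> \<in> G" and uv: "u \<in> E" "v \<in> E"
  \<comment> \<open>Convergence is known only for indices in \<open>E\<close>, so the inverse must
    not leave \<open>E\<close>.\<close>
  have "inv \<sigma> u \<in> E" "inv \<sigma> v \<in> E"
    using permutes_in_image[OF permutes_inv[OF assms(2)[OF \<sigma>]]] uv by auto
  from lim[OF this] lim[OF uv] show "B (inv \<sigma> u) (inv \<sigma> v) = B u v"
    using assms(1) \<sigma> uv unfolding mat_invariant_def mat_act_def by (simp add: LIMSEQ_unique)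
qed

text \<open>\<open>mat_act\<close> moves indices by the inverse; substituting the preimages turns
  this into a condition on \<open>\<sigma>\<close> itself.\<close>

lemma mat_invariantI:
  assumes "\<And>\<sigma>. \<sigma> \<in> G \<Longrightarrow> \<sigma> permutes E"
    and "\<And>\<sigma> u v. \<sigma> \<in> G \<Longrightarrow> u \<in> E \<Longrightarrow> v \<in> E \<Longrightarrow> A u v = A (\<sigma> u) (\<sigma> v)"
  shows "mat_invariant E G A"
  unfolding mat_invariant_def mat_act_def
proof (intro ballI)
  fix \<sigma> u v assume \<sigma>: "\<sigma> \<in> G" and uv: "u \<in> E" "v \<in> E"
  have "inv \<sigma> u \<in> E" "inv \<sigma> v \<in> E"
    using permutes_in_image[OF permutes_inv[OF assms(1)[OF \<sigma>]]] uv by auto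
  from assms(2)[OF \<sigma> this] show "A (inv \<sigma> u) (inv \<sigma> v) = A u v"
    using permutes_inverses(1)[OF assms(1)[OF \<sigma>]] by simp
qed

text \<open>Bolzano-Weierstrass in finite dimension: coordinates are treated one at a time, each
  time thinning out the subsequence already chosen, which keeps the earlier limits.\<close>

lemma simultaneous_convergent_subseq:
  fixes f :: "'i \<Rightarrow> nat \<Rightarrow> real"
  assumes "finite I" "\<And>i. i \<in> I \<Longrightarrow> Bseq (f i)"
  shows "\<exists>s. strict_mono (s :: nat \<Rightarrow> nat) \<and> (\<forall>i\<in>I. convergent (\<lambda>k. f i (s k)))"
  using assms
proof (induction I rule: finite_induct)
  case empty
  then show ?case
    using strict_mono_id by blast
next
  case (insert i I)
  then obtain s :: "nat \<Rightarrow> nat" where s: "strict_mono s" "\<And>j. j \<in> I \<Longrightarrow> convergent (\<lambda>k. f j (s k))"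
    by auto
  \<comment> \<open>Every real sequence has a monotone subsequence, and boundedness makes it
    converge.\<close>
  obtain t :: "nat \<Rightarrow> nat" where t: "strict_mono t" "monoseq (\<lambda>k. f i (s (t k)))"
    using seq_monosub[of "\<lambda>k. f i (s k)"] by auto
  have "Bseq (\<lambda>k. f i (s (t k)))"
    using Bseq_subseq[of "f i" "s \<circ> t"] insert.prems by (simp add: o_def)
  then have "convergent (\<lambda>k. f i (s (t k)))"
    using t(2) Bseq_monoseq_convergent by blast
  moreover have "convergent (\<lambda>k. f j (s (t k)))" if "j \<in> I" for j
    using convergent_subseq_convergent[OF s(2)[OF that] t(1)] by (simp add: o_def)
  ultimately show ?case
    using strict_mono_o[OF s(1) t(1)] by (intro exI[of _ "s \<circ> t"]) (auto simp: o_def)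
qed

section \<open>Attainment of the minimum\<close>

lemma cond_AD:
  assumes "cond_A q n M M' M''" "u \<in> words q n" "v \<in> words q n"
  shows "M u v = M' (zero_word n) (word_diff q n v u)"
    and "M'' u v = M' (zero_word n) (word_diff q n v u) - M' u v"
    and "0 \<le> M' u v" "M' u v \<le> M' (zero_word n) u"
    and "0 \<le> M'' u v" "M'' u v \<le> M'' u u"
proof -
  let ?E = "words q n" and ?z = "zero_word n"
  have "\<forall>u\<in>?E. \<forall>v\<in>?E. M u v = M' ?z (word_diff q n v u) \<and> M'' u v = M' ?z (word_diff q n v u) - M' u v"
    using assms(1) unfolding cond_A_def Let_def by (elim conjE)
  moreover have "\<forall>u\<in>?E. \<forall>v\<in>?E. 0 \<le> M' u v \<and> M' u v \<le> M' ?z u"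
    using assms(1) unfolding cond_A_def Let_def by (elim conjE)
  moreover have "\<forall>u\<in>?E. \<forall>v\<in>?E. 0 \<le> M'' u v \<and> M'' u v \<le> M'' u u"
    using assms(1) unfolding cond_A_def Let_def by (elim conjE)
  ultimately show "M u v = M' ?z (word_diff q n v u)" "M'' u v = M' ?z (word_diff q n v u) - M' u v"
    "0 \<le> M' u v" "M' u v \<le> M' ?z u" "0 \<le> M'' u v" "M'' u v \<le> M'' u u"
    using assms(2,3) by blast+
qed

lemma cond_A_orbit:
  assumes "cond_A q n M M' M''" "u \<in> words q n" "v \<in> words q n" "u' \<in> words q n" "v' \<in> words q n"
    and "\<exists>\<sigma>\<in>Aut q n. {zero_word n, u', v'} = \<sigma> ` {zero_word n, u, v}"
  shows "M' u v = M' u' v'"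
proof -
  let ?E = "words q n" and ?z = "zero_word n"
  from assms(1) have "\<forall>u\<in>?E. \<forall>v\<in>?E. \<forall>u'\<in>?E. \<forall>v'\<in>?E.
      (\<exists>\<sigma>\<in>Aut q n. {?z, u', v'} = \<sigma> ` {?z, u, v}) \<longrightarrow> M' u v = M' u' v'"
    unfolding cond_A_def Let_def by (elim conjE)
  from this[rule_format, OF assms(2-5)] show ?thesis
    using assms(6) by simp
qed

lemma cond_CD:
  assumes "cond_C q n lam \<beta> M M' M'' N" "u \<in> words q n" "v \<in> words q n"
  defines "z \<equiv> zero_word n"
  shows "N u v = - \<beta> * M u v +
      (\<Sum>l\<le>n. lam l * (\<Sum>w\<in>hsphere q n l z. M' (word_diff q n u w) (word_diff q n v w)))"
    and "\<beta> * M' z u \<le> (\<Sum>l\<le>n. lam l * (\<Sum>w\<in>hsphere q n l v. M' u w))"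
    and "\<beta> * (M' z z - M' z u) \<le> (\<Sum>l\<le>n. lam l * (\<Sum>w\<in>hsphere q n l v. M' w w - M' u w))"
    and "\<beta> * M'' u u \<le> (\<Sum>l\<le>n. lam l * (\<Sum>w\<in>hsphere q n l v. M'' u w))"
    and "\<beta> * ((1 - M' z z) - M'' u u) \<le>
      (\<Sum>l\<le>n. lam l * (\<Sum>w\<in>hsphere q n l v. M'' w w - M'' u w))"
proof -
  note C = assms(1)[unfolded cond_C_def Let_def, THEN conjunct2, THEN conjunct2, folded z_def]
  show "N u v = - \<beta> * M u v +
      (\<Sum>l\<le>n. lam l * (\<Sum>w\<in>hsphere q n l z. M' (word_diff q n u w) (word_diff q n v w)))"
    using bspec[OF bspec[OF conjunct1[OF C] assms(2)] assms(3)] .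
  note C' = bspec[OF bspec[OF conjunct2[OF C] assms(2)] assms(3)]
  show "\<beta> * M' z u \<le> (\<Sum>l\<le>n. lam l * (\<Sum>w\<in>hsphere q n l v. M' u w))"
    using C' by (elim conjE)
  show "\<beta> * (M' z z - M' z u) \<le> (\<Sum>l\<le>n. lam l * (\<Sum>w\<in>hsphere q n l v. M' w w - M' u w))"
    using C' by (elim conjE)
  show "\<beta> * M'' u u \<le> (\<Sum>l\<le>n. lam l * (\<Sum>w\<in>hsphere q n l v. M'' u w))"
    using C' by (elim conjE)
  show "\<beta> * ((1 - M' z z) - M'' u u) \<le>
      (\<Sum>l\<le>n. lam l * (\<Sum>w\<in>hsphere q n l v. M'' w w - M'' u w))"
    using C' by (elim conjE)
qed

text \<open>Applying (A)(ii) twice bounds an entry by \<open>M' z u\<close> and then by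
  \<open>M' z z\<close>, with \<open>z\<close> the zero word. These bounds supply the compactness
  behind attainment.\<close>

lemma feasible_entries:
  assumes "q > 0" "cond_A q n M M' M''" "cond_B q n M' M''" "u \<in> words q n" "v \<in> words q n"
  shows "0 \<le> M' u v" "M' u v \<le> 1"
proof -
  let ?z = "zero_word n"
  have z: "?z \<in> words q n"
    using zero_word_in_words[OF assms(1)] .
  \<comment> \<open>The corner of the bordered matrix in (B) is one of its diagonal entries.\<close>
  have "0 \<le> bordered (1 - M' ?z ?z) M'' None None"
    by (rule psd_on_diag_nonneg[of "insert None (Some ` words q n)"])
      (use assms(3) in \<open>auto simp: cond_B_def bordered_psd_on_def Let_def\<close>)
  then have "M' ?z ?z \<le> 1"
    by simp
  then show "0 \<le> M' u v" "M' u v \<le> 1"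
    using cond_AD(3,4)[OF assms(2,4,5)] cond_AD(4)[OF assms(2) z assms(4)] by auto
qed

text \<open>The value set is closed: bounded entries let \<open>M'\<close> converge along a
  subsequence, the other three matrices follow because they are linear in \<open>M'\<close>, and all
  constraints are closed conditions.\<close>

lemma sdp_values_limit:
  assumes q: "q > 0" and mem: "\<And>k. X k \<in> sdp_values q n lam \<beta>" and lim: "X \<longlonglongrightarrow> (x::real)"
  shows "x \<in> sdp_values q n lam \<beta>"
proof -
  let ?E = "words q n" and ?z = "zero_word n" and ?d = "word_diff q n"
  note [simp] = zero_word_in_words[OF q] word_diff_in_words[OF q]
  have "\<forall>k. \<exists>M M' M'' N. X k = real q ^ n * (\<Sum>u\<in>?E. \<Sum>v\<in>?E. M' u v) \<and>
      cond_A q n M M' M'' \<and> cond_B q n M' M'' \<and> cond_C q n lam \<beta> M M' M'' N"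
    using mem unfolding sdp_values_def by blast
  then obtain M M' M'' N where X: "\<And>k. X k = real q ^ n * (\<Sum>u\<in>?E. \<Sum>v\<in>?E. M' k u v)"
    and A: "\<And>k. cond_A q n (M k) (M' k) (M'' k)" and B: "\<And>k. cond_B q n (M' k) (M'' k)"
    and C: "\<And>k. cond_C q n lam \<beta> (M k) (M' k) (M'' k) (N k)"
    by metis
  have "Bseq (\<lambda>k. M' k (fst p) (snd p))" if "p \<in> ?E \<times> ?E" for p
  proof (rule BseqI'[of _ 1])
    show "norm (M' k (fst p) (snd p)) \<le> 1" for k
      using feasible_entries[OF q A B, of "fst p" "snd p" k] that by auto
  qed
  \<comment> \<open>One subsequence serves all entries, as there are finitely many index
    pairs.\<close>
  then obtain s :: "nat \<Rightarrow> nat" where s: "strict_mono s"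
    and conv: "\<And>p. p \<in> ?E \<times> ?E \<Longrightarrow> convergent (\<lambda>k. M' (s k) (fst p) (snd p))"
    using simultaneous_convergent_subseq[of "?E \<times> ?E" "\<lambda>p k. M' k (fst p) (snd p)"] by auto
  define L' where "L' u v = lim (\<lambda>k. M' (s k) u v)" for u v
  \<comment> \<open>The remaining limits are defined by the equations in (A)(i) and (C)(iii), so
    these hold by construction and only convergence is left to show.\<close>
  define L where "L u v = L' ?z (?d v u)" for u v
  define L'' where "L'' u v = L' ?z (?d v u) - L' u v" for u v
  define LN where "LN u v = - \<beta> * L u v +
      (\<Sum>l\<le>n. lam l * (\<Sum>w\<in>hsphere q n l ?z. L' (?d u w) (?d v w)))" for u v
  have l' [tendsto_intros]: "(\<lambda>k. M' (s k) u v) \<longlonglongrightarrow> L' u v" if "u \<in> ?E" "v \<in> ?E" for u v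
    using conv[of "(u, v)"] that unfolding L'_def by (simp add: convergent_LIMSEQ_iff)
  have l [tendsto_intros]: "(\<lambda>k. M (s k) u v) \<longlonglongrightarrow> L u v" if "u \<in> ?E" "v \<in> ?E" for u v
    unfolding L_def cond_AD(1)[OF A that] by (rule l') simp_all
  have l'' [tendsto_intros]: "(\<lambda>k. M'' (s k) u v) \<longlonglongrightarrow> L'' u v" if "u \<in> ?E" "v \<in> ?E" for u v
    unfolding L''_def cond_AD(2)[OF A that] using that by (intro tendsto_diff l') simp_all
  have lN: "(\<lambda>k. N (s k) u v) \<longlonglongrightarrow> LN u v" if "u \<in> ?E" "v \<in> ?E" for u v
    unfolding LN_def cond_CD(1)[OF C that] using that by (intro tendsto_intros) simp_all
  \<comment> \<open>Entrywise convergence is available for words only, and the sums in (C) run over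
    spheres.\<close>
  have sph: "w \<in> ?E" if "w \<in> hsphere q n i v" for w i v
    using that hsphere_subset by blast
  have "cond_A q n L L' L''"
    unfolding cond_A_def Let_def
  proof (intro conjI)
    show "mat_invariant ?E (Aut q n) L"
      by (rule mat_invariant_limit[OF _ _ l])
        (use A in \<open>auto simp: cond_A_def Let_def Aut_permutes\<close>)
    show "mat_invariant ?E (Aut0 q n) L'"
      by (rule mat_invariant_limit[OF _ _ l'])
        (use A in \<open>auto simp: cond_A_def Let_def Aut_permutes Aut0_def\<close>)
    show "mat_invariant ?E (Aut0 q n) L''"
      by (rule mat_invariant_limit[OF _ _ l''])
        (use A in \<open>auto simp: cond_A_def Let_def Aut_permutes Aut0_def\<close>)
    show "\<forall>u\<in>?E. \<forall>v\<in>?E. L u v = L' ?z (?d v u) \<and> L'' u v = L' ?z (?d v u) - L' u v"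
      unfolding L_def L''_def by simp
    show "\<forall>u\<in>?E. \<forall>v\<in>?E. 0 \<le> L' u v \<and> L' u v \<le> L' ?z u"
    proof (intro ballI conjI)
      fix u v assume uv: "u \<in> ?E" "v \<in> ?E"
      show "0 \<le> L' u v" "L' u v \<le> L' ?z u"
        using uv cond_AD(3,4)[OF A uv] LIMSEQ_le_const[OF l'[OF uv]] LIMSEQ_le[OF l'[OF uv] l'[of ?z u]] by auto
    qed
    show "\<forall>u\<in>?E. \<forall>v\<in>?E. 0 \<le> L'' u v \<and> L'' u v \<le> L'' u u"
    proof (intro ballI conjI)
      fix u v assume uv: "u \<in> ?E" "v \<in> ?E"
      show "0 \<le> L'' u v" "L'' u v \<le> L'' u u"
        using uv cond_AD(5,6)[OF A uv] LIMSEQ_le_const[OF l''[OF uv]] LIMSEQ_le[OF l''[OF uv] l''[of u u]] by auto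
    qed
    show "\<forall>u\<in>?E. \<forall>v\<in>?E. \<forall>u'\<in>?E. \<forall>v'\<in>?E.
        (\<exists>\<sigma>\<in>Aut q n. {?z, u', v'} = \<sigma> ` {?z, u, v}) \<longrightarrow> L' u v = L' u' v'"
    proof (intro ballI impI)
      fix u v u' v'
      assume uv: "u \<in> ?E" "v \<in> ?E" and uv': "u' \<in> ?E" "v' \<in> ?E"
        and ex: "\<exists>\<sigma>\<in>Aut q n. {?z, u', v'} = \<sigma> ` {?z, u, v}"
      have "M' k u v = M' k u' v'" for k
        using cond_A_orbit[OF A uv uv' ex] .
      then show "L' u v = L' u' v'"
        using l'[OF uv] l'[OF uv'] LIMSEQ_unique by simp
    qed
  qed
  moreover have "cond_B q n L' L''"
    unfolding cond_B_def Let_def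
  proof (intro conjI)
    show "psd_on ?E L'"
      by (rule psd_on_limit[OF _ l']) (use B in \<open>auto simp: cond_B_def Let_def\<close>)
    show "psd_on ?E L''"
      by (rule psd_on_limit[OF _ l'']) (use B in \<open>auto simp: cond_B_def Let_def\<close>)
    show "bordered_psd_on ?E (1 - L' ?z ?z) L''"
      by (rule bordered_psd_on_limit[of _ "\<lambda>k. 1 - M' (s k) ?z ?z" "\<lambda>k. M'' (s k)"])
        (use B in \<open>auto simp: cond_B_def Let_def intro!: tendsto_intros\<close>)
  qed
  moreover have "cond_C q n lam \<beta> L L' L'' LN"
    unfolding cond_C_def Let_def
  proof (intro conjI)
    show "bordered_psd_on ?E ((\<Sum>l\<le>n. lam l * real (card (hsphere q n l ?z)) * L' ?z ?z) - \<beta>) LN"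
    proof (rule bordered_psd_on_limit)
      show "bordered_psd_on ?E
          ((\<Sum>l\<le>n. lam l * real (card (hsphere q n l ?z)) * M' (s k) ?z ?z) - \<beta>) (N (s k))" for k
        using C[of "s k"] unfolding cond_C_def Let_def by (rule conjunct1)
    qed (auto intro!: tendsto_intros lN)
    show "mat_invariant ?E (Aut0 q n) LN"
      by (rule mat_invariant_limit[OF _ _ lN])
        (use C in \<open>auto simp: cond_C_def Let_def Aut_permutes Aut0_def\<close>)
    show "\<forall>u\<in>?E. \<forall>v\<in>?E. LN u v = - \<beta> * L u v +
        (\<Sum>l\<le>n. lam l * (\<Sum>w\<in>hsphere q n l ?z. L' (?d u w) (?d v w)))"
      unfolding LN_def by simp
    show "\<forall>u\<in>?E. \<forall>v\<in>?E.
        \<beta> * L' ?z u \<le> (\<Sum>l\<le>n. lam l * (\<Sum>w\<in>hsphere q n l v. L' u w)) \<and>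
        \<beta> * (L' ?z ?z - L' ?z u) \<le> (\<Sum>l\<le>n. lam l * (\<Sum>w\<in>hsphere q n l v. L' w w - L' u w)) \<and>
        \<beta> * L'' u u \<le> (\<Sum>l\<le>n. lam l * (\<Sum>w\<in>hsphere q n l v. L'' u w)) \<and>
        \<beta> * ((1 - L' ?z ?z) - L'' u u) \<le>
          (\<Sum>l\<le>n. lam l * (\<Sum>w\<in>hsphere q n l v. L'' w w - L'' u w))" (is "\<forall>u\<in>?E. \<forall>v\<in>?E. ?P u v")
    proof (intro ballI)
      fix u v assume uv: "u \<in> ?E" "v \<in> ?E"
      show "?P u v"
      proof (intro conjI)
        show "\<beta> * L' ?z u \<le> (\<Sum>l\<le>n. lam l * (\<Sum>w\<in>hsphere q n l v. L' u w))"
          by (rule LIMSEQ_le[of "\<lambda>k. \<beta> * M' (s k) ?z u"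
                _ "\<lambda>k. \<Sum>l\<le>n. lam l * (\<Sum>w\<in>hsphere q n l v. M' (s k) u w)"])
            (use cond_CD(2-5)[OF C uv] uv sph in \<open>auto intro!: tendsto_intros\<close>)
        show "\<beta> * (L' ?z ?z - L' ?z u) \<le> (\<Sum>l\<le>n. lam l * (\<Sum>w\<in>hsphere q n l v. L' w w - L' u w))"
          by (rule LIMSEQ_le[of "\<lambda>k. \<beta> * (M' (s k) ?z ?z - M' (s k) ?z u)"
                _ "\<lambda>k. \<Sum>l\<le>n. lam l * (\<Sum>w\<in>hsphere q n l v. M' (s k) w w - M' (s k) u w)"])
            (use cond_CD(2-5)[OF C uv] uv sph in \<open>auto intro!: tendsto_intros\<close>)
        show "\<beta> * L'' u u \<le> (\<Sum>l\<le>n. lam l * (\<Sum>w\<in>hsphere q n l v. L'' u w))"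
          by (rule LIMSEQ_le[of "\<lambda>k. \<beta> * M'' (s k) u u"
                _ "\<lambda>k. \<Sum>l\<le>n. lam l * (\<Sum>w\<in>hsphere q n l v. M'' (s k) u w)"])
            (use cond_CD(2-5)[OF C uv] uv sph in \<open>auto intro!: tendsto_intros\<close>)
        show "\<beta> * ((1 - L' ?z ?z) - L'' u u) \<le>
            (\<Sum>l\<le>n. lam l * (\<Sum>w\<in>hsphere q n l v. L'' w w - L'' u w))"
          by (rule LIMSEQ_le[of "\<lambda>k. \<beta> * ((1 - M' (s k) ?z ?z) - M'' (s k) u u)"
                _ "\<lambda>k. \<Sum>l\<le>n. lam l * (\<Sum>w\<in>hsphere q n l v. M'' (s k) w w - M'' (s k) u w)"])
            (use cond_CD(2-5)[OF C uv] uv sph in \<open>auto intro!: tendsto_intros\<close>)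
      qed
    qed
  qed
  moreover have "x = real q ^ n * (\<Sum>u\<in>?E. \<Sum>v\<in>?E. L' u v)"
  proof (rule LIMSEQ_unique)
    show "(\<lambda>k. X (s k)) \<longlonglongrightarrow> x"
      using LIMSEQ_subseq_LIMSEQ[OF lim s] by (simp add: o_def)
    show "(\<lambda>k. X (s k)) \<longlonglongrightarrow> real q ^ n * (\<Sum>u\<in>?E. \<Sum>v\<in>?E. L' u v)"
      unfolding X by (intro tendsto_intros)
  qed
  ultimately show ?thesis
    unfolding sdp_values_def by blast
qed

lemma sdp_values_nonneg:
  assumes "q > 0" "x \<in> sdp_values q n lam \<beta>"
  shows "0 \<le> x"
proof -
  obtain M M' M'' where x: "x = real q ^ n * (\<Sum>u\<in>words q n. \<Sum>v\<in>words q n. M' u v)"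
    and AB: "cond_A q n M M' M''" "cond_B q n M' M''"
    using assms(2) unfolding sdp_values_def by blast
  show ?thesis
    unfolding x by (intro mult_nonneg_nonneg sum_nonneg feasible_entries(1)[OF assms(1) AB]) auto
qed

lemma sdp_values_min_attained:
  assumes q: "q > 0" and ne: "sdp_values q n lam \<beta> \<noteq> {}"
  shows "\<exists>m\<in>sdp_values q n lam \<beta>. \<forall>x\<in>sdp_values q n lam \<beta>. m \<le> x"
proof -
  let ?S = "sdp_values q n lam \<beta>"
  have bdd: "bdd_below ?S"
    using sdp_values_nonneg[OF q] by (intro bdd_belowI) auto
  \<comment> \<open>A minimizing sequence, squeezed towards the infimum; closedness then puts the
    infimum into the set.\<close>
  have "\<exists>x\<in>?S. x < Inf ?S + inverse (real (Suc k))" for k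
    by (rule cInf_lessD[OF ne]) simp
  then obtain X where X: "\<And>k. X k \<in> ?S" "\<And>k. X k < Inf ?S + inverse (real (Suc k))"
    by metis
  have "X \<longlonglongrightarrow> Inf ?S"
  proof (rule tendsto_sandwich[of "\<lambda>_. Inf ?S"])
    show "\<forall>\<^sub>F k in sequentially. Inf ?S \<le> X k"
      using cInf_lower[OF X(1) bdd] by simp
    show "\<forall>\<^sub>F k in sequentially. X k \<le> Inf ?S + inverse (real (Suc k))"
      using less_imp_le[OF X(2)] by (intro always_eventually allI)
    show "(\<lambda>k. Inf ?S + inverse (real (Suc k))) \<longlonglongrightarrow> Inf ?S"
      using LIMSEQ_inverse_real_of_nat_add .
  qed simp
  then have "Inf ?S \<in> ?S"
    using sdp_values_limit[of q X, OF q X(1)] by blast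
  then show ?thesis
    using cInf_lower[OF _ bdd] by blast
qed

section \<open>The feasible point of a code\<close>

text \<open>Averaging over group elements counts each distinct image equally often, once per element
  of the setwise stabilizer of \<open>C\<close>, so this is also the mean over the orbit of the
  code.\<close>

definition orbit_mean :: "nat \<Rightarrow> nat \<Rightarrow> qword set \<Rightarrow> (qword set \<Rightarrow> real) \<Rightarrow> real" where
  "orbit_mean q n C F = (\<Sum>\<sigma>\<in>Aut q n. F (\<sigma> ` C)) / real (card (Aut q n))"

lemma orbit_mean_const [simp]: "orbit_mean q n C (\<lambda>D. c) = c"
  unfolding orbit_mean_def using id_in_Aut[of q n] by auto

lemma orbit_mean_cong:
  "(\<And>\<sigma>. \<sigma> \<in> Aut q n \<Longrightarrow> F (\<sigma> ` C) = G (\<sigma> ` C)) \<Longrightarrow> orbit_mean q n C F = orbit_mean q n C G"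
  unfolding orbit_mean_def by simp

lemma orbit_mean_mono:
  "(\<And>\<sigma>. \<sigma> \<in> Aut q n \<Longrightarrow> F (\<sigma> ` C) \<le> G (\<sigma> ` C)) \<Longrightarrow> orbit_mean q n C F \<le> orbit_mean q n C G"
  unfolding orbit_mean_def by (simp add: divide_right_mono sum_mono)

lemma orbit_mean_diff:
  "orbit_mean q n C (\<lambda>D. F D - G D) = orbit_mean q n C F - orbit_mean q n C G"
  unfolding orbit_mean_def by (simp add: sum_subtractf diff_divide_distrib)

lemma orbit_mean_cmult: "orbit_mean q n C (\<lambda>D. c * F D) = c * orbit_mean q n C F"
  unfolding orbit_mean_def by (simp add: sum_distrib_left)

lemma orbit_mean_sum:
  "orbit_mean q n C (\<lambda>D. \<Sum>i\<in>I. F i D) = (\<Sum>i\<in>I. orbit_mean q n C (F i))"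
  unfolding orbit_mean_def by (subst sum.swap) (simp add: sum_divide_distrib)

lemmas orbit_mean_linear =
  orbit_mean_diff orbit_mean_cmult orbit_mean_sum

text \<open>Left multiplication by \<open>\<tau>\<close> is an injective self-map of the finite group.\<close>

lemma orbit_mean_shift:
  assumes "\<tau> \<in> Aut q n"
  shows "orbit_mean q n C (\<lambda>D. F (\<tau> ` D)) = orbit_mean q n C F"
proof -
  have "inj_on ((\<circ>) \<tau>) (Aut q n)"
    using fun.inj_map[OF permutes_inj[OF Aut_permutes[OF assms]]] inj_on_subset by blast
  moreover have "(\<circ>) \<tau> ` Aut q n \<subseteq> Aut q n"
    using Aut_comp[OF assms] by auto
  ultimately have "bij_betw ((\<circ>) \<tau>) (Aut q n) (Aut q n)"
    by (intro bij_betw_imageI endo_inj_surj) auto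
  from sum.reindex_bij_betw[OF this, of "\<lambda>\<sigma>. F (\<sigma> ` C)"] show ?thesis
    unfolding orbit_mean_def by (simp add: image_comp)
qed

section \<open>Indicators of codes\<close>

definition word_ind :: "qword set \<Rightarrow> qword \<Rightarrow> real" where
  "word_ind D u = of_bool (u \<in> D)"

lemma word_ind_idem [simp]: "word_ind D u * word_ind D u = word_ind D u"
  unfolding word_ind_def by simp

lemma word_ind_bounds [simp]: "0 \<le> word_ind D u" "word_ind D u \<le> 1"
  unfolding word_ind_def by auto

lemma word_ind_image: "\<tau> \<in> Aut q n \<Longrightarrow> word_ind (\<tau> ` D) (\<tau> u) = word_ind D u"
  using permutes_inj[OF Aut_permutes] unfolding word_ind_def by (auto dest: injD)

lemma prod_word_ind: "finite A \<Longrightarrow> (\<Prod>w\<in>A. word_ind D w) = of_bool (A \<subseteq> D)"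
  unfolding word_ind_def by (induction A rule: finite_induct) auto

lemma sum_word_ind: "finite A \<Longrightarrow> (\<Sum>w\<in>A. word_ind D w) = real (card (D \<inter> A))"
  unfolding word_ind_def by (simp add: Int_commute)

section \<open>Moment matrices of the orbit of a code\<close>

locale invariant_mean =
  fixes q n :: nat and C :: "qword set" and lam :: "nat \<Rightarrow> real" and \<beta> :: real
  assumes q_pos: "q > 0" and code: "C \<subseteq> words q n" and ineqs: "satisfies_ineqs q n lam \<beta> C"
begin

abbreviation "z \<equiv> zero_word n"
abbreviation "E \<equiv> words q n"
abbreviation "avg \<equiv> orbit_mean q n C"
text \<open>The slack of the covering inequality at \<open>v\<close>, with sphere counts written as
  sums of indicators so that means distribute over it.\<close>

abbreviation "excess D v \<equiv> (\<Sum>l\<le>n. lam l * (\<Sum>w\<in>hsphere q n l v. word_ind D w)) - \<beta>"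

text \<open>All four means are normalised by the whole group, not by the images that contain or
  avoid zero. Hence \<open>PM'\<close> and \<open>PM''\<close> add up to \<open>PM\<close>, and
  \<open>PM' z z\<close> is the proportion of images containing zero.\<close>

definition "PM u v = avg (\<lambda>D. word_ind D u * word_ind D v)"
definition "PM' u v = avg (\<lambda>D. word_ind D z * word_ind D u * word_ind D v)"
definition "PM'' u v = avg (\<lambda>D. (1 - word_ind D z) * word_ind D u * word_ind D v)"
definition "PN u v = avg (\<lambda>D. excess D z * word_ind D u * word_ind D v)"

lemma z_in_E [simp]: "z \<in> E"
  using zero_word_in_words[OF q_pos] .

lemma excess_nonneg: "\<sigma> \<in> Aut q n \<Longrightarrow> v \<in> E \<Longrightarrow> 0 \<le> excess (\<sigma> ` C) v"
  using satisfies_ineqs_Aut_image[OF _ code ineqs, of \<sigma>] unfolding satisfies_ineqs_def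
  by (simp add: sum_word_ind)

lemma avg_zero: "avg (\<lambda>D. word_ind D z) = PM' z z"
  unfolding PM'_def by simp

text \<open>Replacing \<open>D\<close> by \<open>\<tau>\<close>
  D\<open>leaves the mean unchanged, while membership of\<close>\<tau> w\<open>in\<close>\<tau>
  \<open>D\<close> is membership of \<open>w\<close> in \<open>D\<close>. The invariance of
  \<open>PM\<close> and \<open>PM'\<close>, as well as (A)(iv), are instances.\<close>

lemma avg_shift:
  assumes "\<tau> \<in> Aut q n"
  shows "avg (\<lambda>D. \<Prod>w\<in>\<tau> ` A. word_ind D w) = avg (\<lambda>D. \<Prod>w\<in>A. word_ind D w)"
proof -
  have "inj_on \<tau> A"
    using permutes_inj[OF Aut_permutes[OF assms]] inj_on_subset by blast
  then have "(\<Prod>w\<in>\<tau> ` A. word_ind (\<tau> ` D) w) = (\<Prod>w\<in>A. word_ind D w)" for D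
    using word_ind_image[OF assms] by (simp add: prod.reindex)
  then show ?thesis
    using orbit_mean_shift[OF assms, of C "\<lambda>D. \<Prod>w\<in>\<tau> ` A. word_ind D w"] by simp
qed

text \<open>Indicators are idempotent, so coinciding words collapse and the moment depends only on
  the set of the three words, as (A)(iv) requires.\<close>

lemma PM'_prod: "PM' u v = avg (\<lambda>D. \<Prod>w\<in>{z, u, v}. word_ind D w)"
  unfolding PM'_def by (intro orbit_mean_cong) (simp add: prod_word_ind, simp add: word_ind_def)

lemma PM_prod: "PM u v = avg (\<lambda>D. \<Prod>w\<in>{u, v}. word_ind D w)"
  unfolding PM_def by (intro orbit_mean_cong) (simp add: prod_word_ind, simp add: word_ind_def)

lemma PM_eq: "PM u v = PM' z (word_diff q n v u)" if "u \<in> E" "v \<in> E"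
proof -
  \<comment> \<open>The doubled \<open>z\<close> gives the set the shape used in
    \<open>PM'_prod\<close>; translation by \<open>u\<close> sends zero to \<open>u\<close> and the
    difference to \<open>v\<close>.\<close>
  have "{u, v} = translation q n u ` {z, z, word_diff q n v u}"
    using that translation_zero translation_word_diff q_pos by simp
  then show ?thesis
    unfolding PM_prod PM'_prod using avg_shift[OF translation_in_Aut[OF q_pos]] by metis
qed

lemma PM''_eq: "PM'' u v = PM u v - PM' u v"
  unfolding PM_def PM'_def PM''_def orbit_mean_diff[symmetric] by (simp add: algebra_simps)

lemma PM'_translate:
  assumes "u \<in> E" "v \<in> E" "w \<in> E"
  shows "PM' (word_diff q n u w) (word_diff q n v w) =
    avg (\<lambda>D. word_ind D w * word_ind D u * word_ind D v)"
proof -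
  have "{w, u, v} = translation q n w ` {z, word_diff q n u w, word_diff q n v w}"
    using assms translation_zero translation_word_diff q_pos by simp
  then have "PM' (word_diff q n u w) (word_diff q n v w) = avg (\<lambda>D. \<Prod>w\<in>{w, u, v}. word_ind D w)"
    unfolding PM'_prod using avg_shift[OF translation_in_Aut[OF q_pos]] by metis
  also have "\<dots> = avg (\<lambda>D. word_ind D w * word_ind D u * word_ind D v)"
    by (intro orbit_mean_cong) (simp add: prod_word_ind, simp add: word_ind_def)
  finally show ?thesis .
qed

text \<open>Translations act transitively, so every word lies in the same proportion of the
  images.\<close>

lemma avg_word_ind: "w \<in> E \<Longrightarrow> avg (\<lambda>D. word_ind D w) = PM' z z"
  using avg_shift[OF translation_in_Aut[OF q_pos], of w "{z}"] translation_zero q_pos avg_zero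
  by simp

text \<open>Multiplying out the excess produces moments of \<open>w\<close>, \<open>u\<close>,
  \<open>v\<close> with \<open>w\<close> on a sphere around zero; translating \<open>w\<close> back
  to zero turns each into an entry of \<open>PM'\<close>.\<close>

lemma PN_eq:
  assumes "u \<in> E" "v \<in> E"
  shows "PN u v = - \<beta> * PM u v +
    (\<Sum>l\<le>n. lam l * (\<Sum>w\<in>hsphere q n l z. PM' (word_diff q n u w) (word_diff q n v w)))"
proof -
  have "(\<Sum>l\<le>n. lam l * (\<Sum>w\<in>hsphere q n l z. PM' (word_diff q n u w) (word_diff q n v w))) =
      (\<Sum>l\<le>n. lam l * (\<Sum>w\<in>hsphere q n l z. avg (\<lambda>D. word_ind D w * word_ind D u * word_ind D v)))"
    by (intro sum.cong refl arg_cong2[where f = "(*)"] PM'_translate assms) (auto dest: subsetD[OF hsphere_subset])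
  moreover have "PN u v = avg (\<lambda>D. (\<Sum>l\<le>n. lam l *
      (\<Sum>w\<in>hsphere q n l z. word_ind D w * word_ind D u * word_ind D v)) - \<beta> * (word_ind D u * word_ind D v))"
    unfolding PN_def by (intro orbit_mean_cong) (simp add: algebra_simps sum_distrib_left)
  ultimately show ?thesis
    by (simp add: orbit_mean_linear PM_def)
qed

lemma Aut0_fixes_zero: "\<tau> \<in> Aut0 q n \<Longrightarrow> \<tau> z = z"
  unfolding Aut0_def by simp

lemma Aut0_Aut: "\<tau> \<in> Aut0 q n \<Longrightarrow> \<tau> \<in> Aut q n"
  unfolding Aut0_def by simp

lemma PM_Aut:
  assumes "\<tau> \<in> Aut q n"
  shows "PM u v = PM (\<tau> u) (\<tau> v)"
  unfolding PM_prod using avg_shift[OF assms, of "{u, v}"] by (simp only: image_insert image_empty)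

lemma PM'_Aut0:
  assumes "\<tau> \<in> Aut0 q n"
  shows "PM' u v = PM' (\<tau> u) (\<tau> v)"
  unfolding PM'_prod using avg_shift[OF Aut0_Aut[OF assms], of "{z, u, v}"] Aut0_fixes_zero[OF assms]
  by (simp only: image_insert image_empty)

text \<open>An isometry fixing zero permutes each sphere around zero, so it only reorders the sums
  in the excess.\<close>

lemma excess_Aut0:
  assumes "\<tau> \<in> Aut0 q n"
  shows "excess (\<tau> ` D) z = excess D z"
proof -
  have p: "\<tau> permutes E"
    using assms Aut0_Aut Aut_permutes by blast
  have "\<tau> ` hsphere q n l z = hsphere q n l z" for l
  proof (rule endo_inj_surj)
    show "\<tau> ` hsphere q n l z \<subseteq> hsphere q n l z"
      using Aut_hdist[OF Aut0_Aut[OF assms] z_in_E] Aut0_fixes_zero[OF assms] permutes_in_image[OF p]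
      unfolding hsphere_def by force
  qed (use permutes_inj[OF p] inj_on_subset in auto)
  then have "(\<Sum>w\<in>hsphere q n l z. word_ind (\<tau> ` D) w) =
      (\<Sum>w\<in>hsphere q n l z. word_ind (\<tau> ` D) (\<tau> w))" for l
    using sum.reindex[of \<tau> "hsphere q n l z" "word_ind (\<tau> ` D)"] permutes_inj[OF p] inj_on_subset
    by (metis (no_types, lifting) comp_apply subset_UNIV sum.cong)
  then show ?thesis
    using word_ind_image[OF Aut0_Aut[OF assms]] by simp
qed

lemma PN_Aut0:
  assumes "\<tau> \<in> Aut0 q n"
  shows "PN u v = PN (\<tau> u) (\<tau> v)"
  unfolding PN_def
  using orbit_mean_shift[OF Aut0_Aut[OF assms], of C
      "\<lambda>D. excess D z * word_ind D (\<tau> u) * word_ind D (\<tau> v)"]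
    excess_Aut0[OF assms] word_ind_image[OF Aut0_Aut[OF assms]] by simp

lemma cond_A: "cond_A q n PM PM' PM''"
  unfolding cond_A_def Let_def
proof (intro conjI)
  have p0: "\<sigma> permutes E" if "\<sigma> \<in> Aut0 q n" for \<sigma>
    using that Aut0_Aut Aut_permutes by blast
  show "mat_invariant E (Aut q n) PM"
    by (rule mat_invariantI) (auto intro: Aut_permutes PM_Aut)
  show "mat_invariant E (Aut0 q n) PM'"
    by (rule mat_invariantI) (auto intro: p0 PM'_Aut0)
  show "mat_invariant E (Aut0 q n) PM''"
  proof (rule mat_invariantI)
    fix \<sigma> u v assume \<sigma>: "\<sigma> \<in> Aut0 q n"
    show "PM'' u v = PM'' (\<sigma> u) (\<sigma> v)"
      unfolding PM''_eq PM_Aut[OF Aut0_Aut[OF \<sigma>], of u v] PM'_Aut0[OF \<sigma>, of u v] ..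
  qed (rule p0)
  show "\<forall>u\<in>E. \<forall>v\<in>E. PM u v = PM' z (word_diff q n v u) \<and>
      PM'' u v = PM' z (word_diff q n v u) - PM' u v"
    using PM_eq PM''_eq by auto
  show "\<forall>u\<in>E. \<forall>v\<in>E. 0 \<le> PM' u v \<and> PM' u v \<le> PM' z u"
  proof (intro ballI conjI)
    fix u v
    have "avg (\<lambda>D. 0) \<le> PM' u v"
      unfolding PM'_def by (intro orbit_mean_mono) simp
    then show "0 \<le> PM' u v"
      by simp
    show "PM' u v \<le> PM' z u"
      unfolding PM'_def by (intro orbit_mean_mono) (simp add: mult_right_le_one_le)
  qed
  show "\<forall>u\<in>E. \<forall>v\<in>E. 0 \<le> PM'' u v \<and> PM'' u v \<le> PM'' u u"
  proof (intro ballI conjI)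
    fix u v
    have "avg (\<lambda>D. 0) \<le> PM'' u v"
      unfolding PM''_def by (intro orbit_mean_mono) simp
    then show "0 \<le> PM'' u v"
      by simp
    show "PM'' u v \<le> PM'' u u"
      unfolding PM''_def by (intro orbit_mean_mono) (simp add: word_ind_def)
  qed
  show "\<forall>u\<in>E. \<forall>v\<in>E. \<forall>u'\<in>E. \<forall>v'\<in>E.
      (\<exists>\<sigma>\<in>Aut q n. {z, u', v'} = \<sigma> ` {z, u, v}) \<longrightarrow> PM' u v = PM' u' v'"
    \<comment> \<open>With the image left unexpanded, the hypothesis rewrites the second set into
      the form that \<open>avg_shift\<close> handles.\<close>
    unfolding PM'_prod using avg_shift by (intro ballI impI, elim bexE) (simp del: image_insert image_empty)
qed

section \<open>Semidefinite and covering constraints\<close>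

lemma psd_on_avg:
  assumes "\<And>u v. u \<in> I \<Longrightarrow> v \<in> I \<Longrightarrow> A u v = avg (\<lambda>D. wt D * f D u * f D v)"
    and "\<And>\<sigma>. \<sigma> \<in> Aut q n \<Longrightarrow> 0 \<le> wt (\<sigma> ` C)"
  shows "psd_on I A"
  by (rule psd_onI_mean[where S = "Aut q n" and wt = "\<lambda>\<sigma>. wt (\<sigma> ` C)" and f = "\<lambda>\<sigma>. f (\<sigma> ` C)"
        and d = "real (card (Aut q n))"])
    (use assms in \<open>auto simp: orbit_mean_def\<close>)

lemma bordered_psd_on_avg:
  assumes A: "\<And>u v. u \<in> E \<Longrightarrow> v \<in> E \<Longrightarrow> A u v = avg (\<lambda>D. wt D * word_ind D u * word_ind D v)"
    and c: "c = avg wt" and "\<And>\<sigma>. \<sigma> \<in> Aut q n \<Longrightarrow> 0 \<le> wt (\<sigma> ` C)"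
  shows "bordered_psd_on E c A"
  unfolding bordered_psd_on_def
proof (rule psd_on_avg)
  fix i j assume ij: "i \<in> insert None (Some ` E)" "j \<in> insert None (Some ` E)"
  \<comment> \<open>Idempotence makes the diagonal linear in the indicator, which is what the border
    must contain.\<close>
  have diag: "A u u = avg (\<lambda>D. wt D * word_ind D u)" if "u \<in> E" for u
    using A[OF that that] by (simp add: mult.assoc)
  \<comment> \<open>\<open>case_option 1 (word_ind D)\<close> is the indicator vector extended by a
    1 at \<open>None\<close>.\<close>
  from ij show "bordered c A i j =
      avg (\<lambda>D. wt D * case_option 1 (word_ind D) i * case_option 1 (word_ind D) j)"
    using A c diag by auto
qed (use assms(3) in auto)

lemma cond_B: "cond_B q n PM' PM''"
  unfolding cond_B_def Let_def
proof (intro conjI)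
  show "psd_on E PM'"
    by (rule psd_on_avg[OF PM'_def]) simp
  show "psd_on E PM''"
    by (rule psd_on_avg[OF PM''_def]) simp
  show "bordered_psd_on E (1 - PM' z z) PM''"
    by (rule bordered_psd_on_avg[OF PM''_def]) (auto simp: orbit_mean_diff avg_zero)
qed

text \<open>Each image has nonnegative excess at \<open>v\<close>; multiplying by the nonnegative
  weight \<open>g D\<close> and averaging keeps the sign. The four inequalities of (C)(iv) differ
  only in the choice of \<open>g\<close>.\<close>

lemma weighted_ineq:
  assumes "\<And>D. 0 \<le> g D" "v \<in> E"
  shows "\<beta> * avg g \<le> (\<Sum>l\<le>n. lam l * (\<Sum>w\<in>hsphere q n l v. avg (\<lambda>D. g D * word_ind D w)))"
proof -
  have "avg (\<lambda>D. 0) \<le> avg (\<lambda>D. g D * excess D v)"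
    using assms excess_nonneg by (intro orbit_mean_mono mult_nonneg_nonneg) auto
  also have "\<dots> = avg (\<lambda>D. (\<Sum>l\<le>n. lam l * (\<Sum>w\<in>hsphere q n l v. g D * word_ind D w)) - \<beta> * g D)"
    by (simp add: algebra_simps sum_distrib_left)
  finally show ?thesis
    by (simp add: orbit_mean_linear)
qed

lemma cond_C: "cond_C q n lam \<beta> PM PM' PM'' PN"
  unfolding cond_C_def Let_def
proof (intro conjI)
  \<comment> \<open>The corner in (C)(i) is the mean excess at zero, because each word of a sphere
    contributes \<open>PM' z z\<close>.\<close>
  have "avg (\<lambda>D. excess D z) = (\<Sum>l\<le>n. lam l * real (card (hsphere q n l z)) * PM' z z) - \<beta>"
  proof -
    have "(\<Sum>w\<in>hsphere q n l z. avg (\<lambda>D. word_ind D w)) = real (card (hsphere q n l z)) * PM' z z" for l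
      by (subst sum.cong[OF refl, of _ _ "\<lambda>_. PM' z z"]) (auto dest: subsetD[OF hsphere_subset] simp: avg_word_ind)
    then show ?thesis
      by (simp add: orbit_mean_linear mult.assoc)
  qed
  then show "bordered_psd_on E ((\<Sum>l\<le>n. lam l * real (card (hsphere q n l z)) * PM' z z) - \<beta>) PN"
    by (intro bordered_psd_on_avg[OF PN_def _ excess_nonneg]) simp_all
  show "mat_invariant E (Aut0 q n) PN"
    using PN_Aut0 Aut0_Aut Aut_permutes by (intro mat_invariantI) blast+
  show "\<forall>u\<in>E. \<forall>v\<in>E. PN u v = - \<beta> * PM u v +
      (\<Sum>l\<le>n. lam l * (\<Sum>w\<in>hsphere q n l z. PM' (word_diff q n u w) (word_diff q n v w)))"
    using PN_eq by blast
  show "\<forall>u\<in>E. \<forall>v\<in>E.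
      \<beta> * PM' z u \<le> (\<Sum>l\<le>n. lam l * (\<Sum>w\<in>hsphere q n l v. PM' u w)) \<and>
      \<beta> * (PM' z z - PM' z u) \<le> (\<Sum>l\<le>n. lam l * (\<Sum>w\<in>hsphere q n l v. PM' w w - PM' u w)) \<and>
      \<beta> * PM'' u u \<le> (\<Sum>l\<le>n. lam l * (\<Sum>w\<in>hsphere q n l v. PM'' u w)) \<and>
      \<beta> * ((1 - PM' z z) - PM'' u u) \<le>
        (\<Sum>l\<le>n. lam l * (\<Sum>w\<in>hsphere q n l v. PM'' w w - PM'' u w))"
  proof (intro ballI conjI)
    fix u v assume v: "v \<in> E"
    have zz: "PM' z z = avg (\<lambda>D. word_ind D z)"
      by (simp add: PM'_def)
    have diag: "PM'' u u = avg (\<lambda>D. (1 - word_ind D z) * word_ind D u)"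
      "PM' u u = avg (\<lambda>D. word_ind D z * word_ind D u)" for u
      by (simp_all add: PM''_def PM'_def mult.assoc)
    have zu: "PM' z u = avg (\<lambda>D. word_ind D z * word_ind D u)"
      by (simp add: PM'_def)
    \<comment> \<open>Weights for the second and fourth inequality: images avoiding \<open>u\<close>
      that contain, respectively avoid, zero. The first and third use images containing
      \<open>u\<close> instead.\<close>
    have nonneg: "0 \<le> word_ind D z * (1 - word_ind D u)"
      "0 \<le> (1 - word_ind D z) * (1 - word_ind D u)" for D
      by simp_all
    show "\<beta> * PM' z u \<le> (\<Sum>l\<le>n. lam l * (\<Sum>w\<in>hsphere q n l v. PM' u w))"
      using weighted_ineq[of "\<lambda>D. word_ind D z * word_ind D u", OF _ v] by (simp add: zu PM'_def)
    show "\<beta> * (PM' z z - PM' z u) \<le> (\<Sum>l\<le>n. lam l * (\<Sum>w\<in>hsphere q n l v. PM' w w - PM' u w))"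
      \<comment> \<open>Reducing diagonal entries to two indicators first lets the difference factor
        through \<open>1 - word_ind D u\<close>.\<close>
      using weighted_ineq[OF nonneg(1) v]
      unfolding zu zz diag unfolding PM'_def orbit_mean_diff[symmetric] by (simp add: algebra_simps)
    show "\<beta> * PM'' u u \<le> (\<Sum>l\<le>n. lam l * (\<Sum>w\<in>hsphere q n l v. PM'' u w))"
      using weighted_ineq[of "\<lambda>D. (1 - word_ind D z) * word_ind D u", OF _ v]
      unfolding diag by (simp add: PM''_def)
    have "1 - PM' z z - PM'' u u = avg (\<lambda>D. (1 - word_ind D z) - (1 - word_ind D z) * word_ind D u)"
      by (simp only: zz diag orbit_mean_diff orbit_mean_const word_ind_idem)
    also have "\<dots> = avg (\<lambda>D. (1 - word_ind D z) * (1 - word_ind D u))"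
      by (intro orbit_mean_cong) (simp add: algebra_simps)
    finally have outside: "1 - PM' z z - PM'' u u = \<dots>" .
    have "PM'' w w - PM'' u w = avg (\<lambda>D. (1 - word_ind D z) * (1 - word_ind D u) * word_ind D w)" for w
      unfolding diag unfolding PM''_def orbit_mean_diff[symmetric] by (simp add: algebra_simps)
    then show "\<beta> * ((1 - PM' z z) - PM'' u u) \<le>
        (\<Sum>l\<le>n. lam l * (\<Sum>w\<in>hsphere q n l v. PM'' w w - PM'' u w))"
      using weighted_ineq[OF nonneg(2) v] outside by simp
  qed
qed

lemma sum_word_ind_image:
  assumes "\<sigma> \<in> Aut q n"
  shows "(\<Sum>u\<in>E. word_ind (\<sigma> ` C) u) = real (card C)"
proof -
  have "\<sigma> ` C \<subseteq> E"
    using code permutes_image[OF Aut_permutes[OF assms]] by blast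
  moreover have "card (\<sigma> ` C) = card C"
    using permutes_inj[OF Aut_permutes[OF assms]] by (metis card_image inj_on_subset subset_UNIV)
  ultimately show ?thesis
    by (simp add: sum_word_ind Int_absorb2)
qed

text \<open>For one image the double sum is \<open>card C\<close> squared if the image contains zero
  and 0 otherwise, so the mean is \<open>card C\<close> squared times
  \<open>PM' z z\<close>.\<close>

lemma objective: "real q ^ n * (\<Sum>u\<in>E. \<Sum>v\<in>E. PM' u v) = real (card C) ^ 3"
proof -
  have "(\<Sum>u\<in>E. \<Sum>v\<in>E. PM' u v) =
      avg (\<lambda>D. word_ind D z * (\<Sum>u\<in>E. word_ind D u) * (\<Sum>v\<in>E. word_ind D v))"
    unfolding PM'_def orbit_mean_sum[symmetric] mult.assoc sum_product
    by (simp add: sum_distrib_left)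
  also have "\<dots> = avg (\<lambda>D. real (card C) ^ 2 * word_ind D z)"
    by (intro orbit_mean_cong) (simp add: sum_word_ind_image power2_eq_square)
  also have "\<dots> = real (card C) ^ 2 * PM' z z"
    by (simp add: orbit_mean_cmult avg_zero)
  finally have sum: "(\<Sum>u\<in>E. \<Sum>v\<in>E. PM' u v) = real (card C) ^ 2 * PM' z z" .
  \<comment> \<open>All words have the same mean indicator, and these means add up to the size of an
    image, so \<open>PM' z z\<close> is the density of \<open>C\<close>.\<close>
  have "real q ^ n * PM' z z = (\<Sum>w\<in>E. avg (\<lambda>D. word_ind D w))"
    by (simp add: avg_word_ind card_words)
  also have "\<dots> = avg (\<lambda>D. \<Sum>w\<in>E. word_ind D w)"
    by (simp add: orbit_mean_sum)
  also have "\<dots> = avg (\<lambda>D. real (card C))"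
    by (intro orbit_mean_cong) (simp add: sum_word_ind_image)
  finally have "real q ^ n * PM' z z = real (card C)"
    by simp
  then show ?thesis
    unfolding sum by (simp add: power2_eq_square power3_eq_cube mult_ac)
qed

lemma card_cubed_in_sdp_values: "real (card C) ^ 3 \<in> sdp_values q n lam \<beta>"
  unfolding sdp_values_def using objective cond_A cond_B cond_C by (auto intro!: exI)

end

theorem theorem2p5:
  fixes q n r :: nat and lam :: "nat \<Rightarrow> real" and \<beta> :: real
  assumes "q \<ge> 2" and "n \<ge> 1" and "r \<le> n"
    and "\<And>i. i \<le> n \<Longrightarrow> lam i \<ge> 0" and "\<beta> > 0"
    and "\<And>C. C \<subseteq> words q n \<Longrightarrow> has_covering_radius q n C r \<Longrightarrow> satisfies_ineqs q n lam \<beta> C"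
  shows "\<exists>m. m \<in> sdp_values q n lam \<beta> \<and> (\<forall>x\<in>sdp_values q n lam \<beta>. m \<le> x) \<and>
           real (covering_number q n r) ^ 3 \<ge> m"
proof -
  obtain C where C: "C \<subseteq> words q n" "has_covering_radius q n C r" "card C = covering_number q n r"
    using covering_number_attained[OF assms(1,3)] .
  interpret invariant_mean q n C lam \<beta>
    using assms(1) C assms(6) by unfold_locales auto
  \<comment> \<open>Besides giving the bound, this member shows that the value set is nonempty, as
    attainment requires.\<close>
  have "real (covering_number q n r) ^ 3 \<in> sdp_values q n lam \<beta>"
    using card_cubed_in_sdp_values C(3) by simp
  then show ?thesis
    using sdp_values_min_attained[OF q_pos, of n lam \<beta>] by blast
qed

end
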